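(* For every $d\ge1$ the constant $\kappa_d$ is well defined (i.e. the limit $\kappa_d=\lim_{n\to\infty}a_d(n)^{1/n^d}$ exists), and for every $n\ge1$: (1) $\kappa_d^{\,n^d}\,2^{-dn^{d-1}}\le a_d(n)\le \kappa_d^{\,(n+1)^d}$; (2) $\left|\frac{1}{n^d}\log a_d(n)-\log\kappa_d\right|\le\frac{d\log 2}{n}$.
   Context: For integers $d,n\ge1$, $T_d(n)$ is the Cayley graph of $(\mathbb{Z}/n\mathbb{Z})^d$ with respect to $\{\pm e_1,\dots,\pm e_d\}\setminus\{0\}$ ($e_i$ the standard basis vectors); it is a simple graph, and $T_d(1)$ is a single vertex with no edges. $a_d(n)$ is the number of independent sets of $T_d(n)$ (including the empty set), so $a_d(1)=2$. *)

theory Defs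
  imports Complex_Main "HOL-Algebra.Product_Groups"
begin

text \<open>A simple graph is a pair of a vertex set and a set of two-element edges.\<close>

type_synonym 'v graph = "'v set \<times> 'v set set"

definition independent_sets :: "'v graph \<Rightarrow> 'v set set" where
  "independent_sets = (\<lambda>(V, E). {I. I \<subseteq> V \<and> (\<forall>x\<in>I. \<forall>y\<in>I. {x, y} \<notin> E)})"

text \<open>
  The undirected Cayley graph; it is simple when \<open>S\<close> does not contain the neutral element.
  The connection set \<open>S\<close> is meant to be symmetric.
\<close>

definition cayley_graph :: "('a, 'b) monoid_scheme \<Rightarrow> 'a set \<Rightarrow> 'a graph" where
  "cayley_graph G S = (carrier G, {{x, x \<otimes>\<^bsub>G\<^esub> s} | x s. x \<in> carrier G \<and> s \<in> S})"

definition torus_group :: "nat \<Rightarrow> nat \<Rightarrow> (nat \<Rightarrow> int) monoid" where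
  "torus_group d n = product_group {..<d} (\<lambda>_. integer_mod_group n)"

text \<open>
  Residues are represented by \<open>{0..<n}\<close>, so the class of \<open>1\<close> is \<open>1 mod n\<close>, which is \<open>0\<close> for
  \<open>n = 1\<close>.
\<close>

definition torus_unit :: "nat \<Rightarrow> nat \<Rightarrow> nat \<Rightarrow> nat \<Rightarrow> int" where
  "torus_unit d n i = (\<lambda>j\<in>{..<d}. if j = i then 1 mod int n else 0)"

definition torus_gens :: "nat \<Rightarrow> nat \<Rightarrow> (nat \<Rightarrow> int) set" where
  "torus_gens d n =
     (torus_unit d n ` {..<d} \<union> (\<lambda>i. inv\<^bsub>torus_group d n\<^esub> (torus_unit d n i)) ` {..<d})
       - {\<one>\<^bsub>torus_group d n\<^esub>}"

definition torus_graph :: "nat \<Rightarrow> nat \<Rightarrow> (nat \<Rightarrow> int) graph" where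
  "torus_graph d n = cayley_graph (torus_group d n) (torus_gens d n)"

definition num_indep :: "nat \<Rightarrow> nat \<Rightarrow> nat" where
  "num_indep d n = card (independent_sets (torus_graph d n))"

text \<open>
  The term for \<open>n = 0\<close> (where the group is the infinite one) is irrelevant to the limit.
\<close>

definition indep_root :: "nat \<Rightarrow> nat \<Rightarrow> real" where
  "indep_root d n = real (num_indep d n) powr (1 / real (n ^ d))"

definition kappa :: "nat \<Rightarrow> real" where
  "kappa d = lim (indep_root d)"

end

theory Submission
  imports Defs
begin

text \<open>
  Compare the torus with the open box \<open>{0..<n}\<^sup>d\<close>, and let \<open>b(n)\<close> be the number of independent
  sets of the latter. Dropping the wrap-around edges gives \<open>a(n) \<le> b(n)\<close>, and the box of side
  \<open>n - 1\<close> does not meet those edges, so \<open>b(n - 1) \<le> a(n)\<close>. Tiling a box of side \<open>k n\<close> gives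
  \<open>b(k n) \<le> b(n)^(k^d)\<close>, while boxes of side \<open>n\<close> separated by gaps of width one give
  \<open>b(n)^(k^d) \<le> b(k (n + 1))\<close>. Comparing both on the box of side \<open>m (n + 1)\<close> shows
  \<open>ln b(n) / (n + 1)^d \<le> ln b(m) / m^d\<close> for all \<open>m\<close> and \<open>n\<close>, so the infimum \<open>K\<close> of the right-hand
  sides separates the two families. As \<open>b(n) \<le> b(n - 1) 2^(d n^(d - 1))\<close>, the numbers
  \<open>ln a(n) / n^d\<close> lie within \<open>d ln 2 / n\<close> of \<open>K = ln \<kappa>\<close>.
\<close>

section \<open>Counting independent sets under embeddings and unions\<close>

lemma independent_sets_iff:
  "I \<in> independent_sets (V, E) \<longleftrightarrow> I \<subseteq> V \<and> (\<forall>x\<in>I. \<forall>y\<in>I. {x, y} \<notin> E)"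
  by (simp add: independent_sets_def)

lemma independent_sets_subset_Pow: "independent_sets (V, E) \<subseteq> Pow V"
  by (auto simp: independent_sets_iff)

lemma finite_independent_sets: "finite V \<Longrightarrow> finite (independent_sets (V, E))"
  by (meson finite_Pow_iff finite_subset independent_sets_subset_Pow)

lemma card_independent_sets_le_pow2:
  "finite V \<Longrightarrow> card (independent_sets (V, E)) \<le> 2 ^ card V"
  by (metis card_Pow card_mono finite_Pow_iff independent_sets_subset_Pow)

lemma card_independent_sets_pos: "finite V \<Longrightarrow> 0 < card (independent_sets (V, E))"
  using finite_independent_sets[of V E]
  by (subst card_gt_0_iff) (auto simp: independent_sets_iff intro!: exI[of _ "{}"])

text \<open>Taking images is injective on subsets of \<open>V\<close>, and an \<open>F\<close>-edge
  inside an image pulls back to an \<open>E\<close>-edge. With \<open>f = id\<close> this is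
  monotonicity under adding vertices and under deleting edges.\<close>

lemma card_independent_sets_embed:
  assumes "finite W" "inj_on f V" "f ` V \<subseteq> W"
    and edge: "\<And>x y. x \<in> V \<Longrightarrow> y \<in> V \<Longrightarrow> {f x, f y} \<in> F \<Longrightarrow> {x, y} \<in> E"
  shows "card (independent_sets (V, E)) \<le> card (independent_sets (W, F))"
proof (rule card_inj_on_le[of "image f"])
  show "inj_on (image f) (independent_sets (V, E))"
    using assms(2) independent_sets_subset_Pow inj_on_image_Pow inj_on_subset by metis
  show "image f ` independent_sets (V, E) \<subseteq> independent_sets (W, F)"
  proof clarify
    fix I assume "I \<in> independent_sets (V, E)"
    then have "I \<subseteq> V" "\<forall>x\<in>I. \<forall>y\<in>I. {x, y} \<notin> E"
      by (simp_all add: independent_sets_iff)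
    then show "f ` I \<in> independent_sets (W, F)"
      using assms(3) edge unfolding independent_sets_iff by blast
  qed
  show "finite (independent_sets (W, F))"
    using assms(1) by (rule finite_independent_sets)
qed

text \<open>An independent set of the union is determined by its traces on \<open>V\<close> and
  \<open>W\<close>, which are again independent; the two parts may overlap.\<close>

lemma card_independent_sets_Un_le:
  assumes "finite V" "finite W"
  shows "card (independent_sets (V \<union> W, E))
         \<le> card (independent_sets (V, E)) * card (independent_sets (W, E))"
proof -
  have "inj_on (\<lambda>I. (I \<inter> V, I \<inter> W)) (independent_sets (V \<union> W, E))"
    by (rule inj_onI) (fastforce simp: independent_sets_iff)
  moreover have "(\<lambda>I. (I \<inter> V, I \<inter> W)) ` independent_sets (V \<union> W, E)
      \<subseteq> independent_sets (V, E) \<times> independent_sets (W, E)"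
    by (auto simp: independent_sets_iff)
  ultimately show ?thesis
    unfolding card_cartesian_product[symmetric]
    using assms by (intro card_inj_on_le finite_cartesian_product finite_independent_sets)
qed

text \<open>Without edges across, the union of two independent sets is independent, and disjointness
  lets both be recovered from it.\<close>

lemma card_independent_sets_Un_ge:
  assumes "finite V" "finite W" "V \<inter> W = {}"
    and sep: "\<And>x y. x \<in> V \<Longrightarrow> y \<in> W \<Longrightarrow> {x, y} \<notin> E"
  shows "card (independent_sets (V, E)) * card (independent_sets (W, E))
         \<le> card (independent_sets (V \<union> W, E))"
proof -
  let ?f = "\<lambda>(I, J). I \<union> J"
  have "inj_on ?f (independent_sets (V, E) \<times> independent_sets (W, E))"
    using assms(3)
    by (intro inj_on_inverseI[where g = "\<lambda>U. (U \<inter> V, U \<inter> W)"])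
      (auto simp: independent_sets_iff, blast+)
  moreover have "?f ` (independent_sets (V, E) \<times> independent_sets (W, E))
      \<subseteq> independent_sets (V \<union> W, E)"
  proof -
    have "{y, x} \<notin> E" if "x \<in> V" "y \<in> W" for x y
      using sep[OF that] by (simp add: insert_commute)
    then have "I \<union> J \<in> independent_sets (V \<union> W, E)"
      if "I \<in> independent_sets (V, E)" "J \<in> independent_sets (W, E)" for I J
      using that sep unfolding independent_sets_iff by blast
    then show ?thesis by auto
  qed
  ultimately show ?thesis
    unfolding card_cartesian_product[symmetric]
    using assms(1,2) by (intro card_inj_on_le finite_independent_sets finite_UnI)
qed

lemma card_independent_sets_UN_le:
  assumes "finite C" "\<And>c. c \<in> C \<Longrightarrow> finite (W c)"
  shows "card (independent_sets (\<Union>c\<in>C. W c, E)) \<le> (\<Prod>c\<in>C. card (independent_sets (W c, E)))"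
  using assms
proof (induction C rule: finite_induct)
  case empty
  then show ?case using card_independent_sets_le_pow2[of "{}" E] by simp
next
  case (insert c C)
  have "card (independent_sets (\<Union>c\<in>insert c C. W c, E))
      \<le> card (independent_sets (W c, E)) * card (independent_sets (\<Union>c\<in>C. W c, E))"
    using card_independent_sets_Un_le[of "W c" "\<Union>c\<in>C. W c" E] insert by simp
  also have "\<dots> \<le> card (independent_sets (W c, E)) * (\<Prod>c\<in>C. card (independent_sets (W c, E)))"
    using insert by simp
  finally show ?case using insert by simp
qed

lemma card_independent_sets_UN_ge:
  assumes "finite C" "\<And>c. c \<in> C \<Longrightarrow> finite (W c)"
    and "\<And>c c'. c \<in> C \<Longrightarrow> c' \<in> C \<Longrightarrow> c \<noteq> c' \<Longrightarrow> W c \<inter> W c' = {}"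
    and "\<And>c c' x y. c \<in> C \<Longrightarrow> c' \<in> C \<Longrightarrow> c \<noteq> c' \<Longrightarrow> x \<in> W c \<Longrightarrow> y \<in> W c' \<Longrightarrow> {x, y} \<notin> E"
  shows "(\<Prod>c\<in>C. card (independent_sets (W c, E))) \<le> card (independent_sets (\<Union>c\<in>C. W c, E))"
  using assms
proof (induction C rule: finite_induct)
  case empty
  then show ?case using card_independent_sets_pos[of "{}" E] by simp
next
  case (insert c C)
  have "(\<Prod>c\<in>C. card (independent_sets (W c, E))) \<le> card (independent_sets (\<Union>c\<in>C. W c, E))"
    by (rule insert.IH) (simp_all add: insert.prems(1,2), meson insert.prems(3) insertCI)
  then have "(\<Prod>c\<in>insert c C. card (independent_sets (W c, E)))
      \<le> card (independent_sets (W c, E)) * card (independent_sets (\<Union>c\<in>C. W c, E))"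
    using insert.hyps by simp
  also have "\<dots> \<le> card (independent_sets (W c \<union> (\<Union>c\<in>C. W c), E))"
  proof (rule card_independent_sets_Un_ge)
    show "finite (W c)" "finite (\<Union>c\<in>C. W c)"
      using insert.hyps insert.prems(1) by auto
    show "W c \<inter> (\<Union>c\<in>C. W c) = {}"
      using insert.hyps insert.prems(2) by blast
    show "{x, y} \<notin> E" if "x \<in> W c" "y \<in> (\<Union>c\<in>C. W c)" for x y
      using that insert.hyps insert.prems(3) by blast
  qed
  finally show ?case by simp
qed

section \<open>Boxes in the integer lattice and their translates\<close>

text \<open>The nearest-neighbour edges are taken on all functions, not only inside a box:
  \<open>independent_sets\<close> looks only at pairs of chosen vertices, so one edge set serves
  every box and every translate.\<close>

definition grid_edges :: "nat \<Rightarrow> (nat \<Rightarrow> int) set set" where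
  "grid_edges d = {{x, x(i := x i + 1)} | x i. i < d}"

definition box :: "nat \<Rightarrow> nat \<Rightarrow> (nat \<Rightarrow> int) set" where
  "box d n = {..<d} \<rightarrow>\<^sub>E {0..<int n}"

definition box_indep :: "nat \<Rightarrow> nat \<Rightarrow> nat" where
  "box_indep d n = card (independent_sets (box d n, grid_edges d))"

lemma grid_edges_iff:
  "{x, y} \<in> grid_edges d \<longleftrightarrow> (\<exists>i<d. y = x(i := x i + 1) \<or> x = y(i := y i + 1))"
  unfolding grid_edges_def doubleton_eq_iff mem_Collect_eq by blast

lemma grid_edge_dist: "{x, y} \<in> grid_edges d \<Longrightarrow> \<bar>x j - y j\<bar> \<le> 1"
  by (auto simp: grid_edges_iff)

lemma finite_box [simp]: "finite (box d n)"
  by (simp add: box_def finite_PiE)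

lemma card_box: "card (box d n) = n ^ d"
  by (simp add: box_def card_PiE)

lemma box_mono: "m \<le> n \<Longrightarrow> box d m \<subseteq> box d n"
  unfolding box_def by (rule PiE_mono) auto

lemma box_indep_pos: "0 < box_indep d n"
  by (simp add: box_indep_def card_independent_sets_pos)

text \<open>Translation to the cell with index \<open>c\<close> in a partition into cells of side
  \<open>m\<close>. Coordinates from \<open>d\<close> on stay fixed, so that points of a box keep
  the value \<open>undefined\<close> there.\<close>

definition shift :: "nat \<Rightarrow> nat \<Rightarrow> (nat \<Rightarrow> int) \<Rightarrow> (nat \<Rightarrow> int) \<Rightarrow> nat \<Rightarrow> int" where
  "shift d m c x = (\<lambda>j. x j + (if j < d then int m * c j else 0))"

lemma inj_shift: "inj (shift d m c)"
  by (rule injI) (simp add: shift_def fun_eq_iff)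

lemma shift_grid_edge: "{shift d m c x, shift d m c y} \<in> grid_edges d \<longleftrightarrow> {x, y} \<in> grid_edges d"
proof -
  have "(shift d m c z)(i := shift d m c z i + 1) = shift d m c (z(i := z i + 1))" for z i
    by (auto simp: shift_def)
  then show ?thesis
    unfolding grid_edges_iff by (simp add: inj_eq[OF inj_shift])
qed

text \<open>A translation is injective and both preserves and reflects grid edges, so it and its
  inverse are embeddings.\<close>

lemma card_independent_sets_shift:
  assumes "finite V"
  shows "card (independent_sets (shift d m c ` V, grid_edges d)) = card (independent_sets (V, grid_edges d))"
proof (rule antisym)
  let ?g = "inv_into UNIV (shift d m c)"
  show "card (independent_sets (shift d m c ` V, grid_edges d)) \<le> card (independent_sets (V, grid_edges d))"
    using assms inj_shift[of d m c] shift_grid_edge[of d m c]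
    by (intro card_independent_sets_embed[where f = ?g]) (auto simp: inj_on_def)
  show "card (independent_sets (V, grid_edges d)) \<le> card (independent_sets (shift d m c ` V, grid_edges d))"
    using assms inj_shift[of d m c] shift_grid_edge[of d m c]
    by (intro card_independent_sets_embed[where f = "shift d m c"]) (auto simp: inj_on_def)
qed

section \<open>Tiling, packing and growth of boxes\<close>

lemma box_indep_mult_le:
  assumes "n \<ge> 1"
  shows "box_indep d (k * n) \<le> box_indep d n ^ (k ^ d)"
proof -
  let ?U = "\<Union>c\<in>box d k. shift d n c ` box d n"
  have "box d (k * n) \<subseteq> ?U"
  proof
    fix x assume x: "x \<in> box d (k * n)"
    \<comment> \<open>Coordinatewise division with remainder: \<open>c\<close> is the index of the
      cell containing \<open>x\<close>, and \<open>y\<close> is the position of \<open>x\<close>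
      within that cell.\<close>
    define c where "c = (\<lambda>j\<in>{..<d}. x j div int n)"
    define y where "y = (\<lambda>j\<in>{..<d}. x j mod int n)"
    have "c \<in> box d k"
      unfolding box_def
    proof (rule PiE_I)
      fix j assume j: "j \<in> {..<d}"
      then have xj: "0 \<le> x j" "x j < int k * int n" using x by (auto simp: box_def PiE_iff)
      have "x j div int n * int n + x j mod int n = x j" "0 \<le> x j mod int n"
        using assms by simp_all
      then have "x j div int n * int n < int k * int n" using xj by linarith
      then have "x j div int n < int k" by (simp add: mult_less_cancel_right_disj)
      with xj show "c j \<in> {0..<int k}"
        using assms j by (auto simp: c_def pos_imp_zdiv_nonneg_iff)
    qed (simp add: c_def)
    moreover have "y \<in> box d n"
      using assms by (auto simp: box_def y_def)
    moreover have "x = shift d n c y"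
      using x by (auto simp: shift_def c_def y_def box_def PiE_iff extensional_def fun_eq_iff)
    ultimately show "x \<in> ?U" by blast
  qed
  then have "box_indep d (k * n) \<le> card (independent_sets (?U, grid_edges d))"
    unfolding box_indep_def by (intro card_independent_sets_embed[where f = id]) auto
  also have "\<dots> \<le> (\<Prod>c\<in>box d k. card (independent_sets (shift d n c ` box d n, grid_edges d)))"
    by (rule card_independent_sets_UN_le) auto
  also have "\<dots> = box_indep d n ^ (k ^ d)"
    by (simp add: card_independent_sets_shift box_indep_def card_box)
  finally show ?thesis .
qed

text \<open>Each cell of side \<open>n + 1\<close> holds a box of side \<open>n\<close>; the spare
  layer leaves no edge between boxes in different cells, so independent sets can be chosen in them
  independently.\<close>

lemma box_indep_power_le: "box_indep d n ^ (k ^ d) \<le> box_indep d (k * (n + 1))"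
proof -
  let ?W = "\<lambda>c. shift d (n + 1) c ` box d n"
  have sep: "\<exists>j. \<bar>x j - y j\<bar> > 1"
    if c: "c \<in> box d k" "c' \<in> box d k" "c \<noteq> c'" and xy: "x \<in> ?W c" "y \<in> ?W c'" for c c' x y
  proof -
    obtain j where j: "j < d" "c j \<noteq> c' j"
      using c PiE_ext unfolding box_def by (metis lessThan_iff)
    obtain u v where u: "u \<in> box d n" "x = shift d (n + 1) c u"
      and v: "v \<in> box d n" "y = shift d (n + 1) c' v"
      using xy by auto
    have uv: "0 \<le> u j" "u j < int n" "0 \<le> v j" "v j < int n"
      using u v j by (auto simp: box_def PiE_iff)
    \<comment> \<open>The cell offset \<open>p\<close> is at least \<open>n + 1\<close> in absolute
      value, while \<open>u j - v j\<close> is at most \<open>n - 1\<close>; hence \<open>x\<close>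
      and \<open>y\<close> differ by at least 2 in coordinate \<open>j\<close>.\<close>
    define p where "p = int (n + 1) * (c j - c' j)"
    have "int (n + 1) * 1 \<le> \<bar>p\<bar>"
      unfolding p_def using j by (subst abs_mult, intro mult_mono) auto
    moreover have "x j - y j = (u j - v j) + p"
      using u v j by (simp add: p_def shift_def algebra_simps)
    ultimately have "\<bar>x j - y j\<bar> > 1" using uv by (smt (verit) of_nat_Suc Suc_eq_plus1)
    then show ?thesis ..
  qed
  have "box_indep d n ^ (k ^ d) = (\<Prod>c\<in>box d k. card (independent_sets (?W c, grid_edges d)))"
    by (simp add: card_independent_sets_shift box_indep_def card_box del: of_nat_add of_nat_Suc)
  also have "\<dots> \<le> card (independent_sets (\<Union>c\<in>box d k. ?W c, grid_edges d))"
  proof (rule card_independent_sets_UN_ge)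
    fix c c' assume c: "c \<in> box d k" "c' \<in> box d k" "c \<noteq> c'"
    show "?W c \<inter> ?W c' = {}" using sep[OF c] by fastforce
    show "{x, y} \<notin> grid_edges d" if "x \<in> ?W c" "y \<in> ?W c'" for x y
      using sep[OF c that] grid_edge_dist by (meson not_le)
  qed auto
  also have "\<dots> \<le> box_indep d (k * (n + 1))"
    unfolding box_indep_def
  proof (rule card_independent_sets_embed[where f = id])
    have "shift d (n + 1) c x \<in> box d (k * (n + 1))" if c: "c \<in> box d k" and x: "x \<in> box d n" for c x
      unfolding box_def
    proof (rule PiE_I)
      fix j assume "j \<in> {..<d}"
      then have j: "j < d" "0 \<le> c j" "c j < int k" "0 \<le> x j" "x j < int n"
        using c x by (auto simp: box_def PiE_iff)
      then have "int (n + 1) * (c j + 1) \<le> int (n + 1) * int k" by (intro mult_left_mono) auto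
      with j show "shift d (n + 1) c x j \<in> {0..<int (k * (n + 1))}"
        by (auto simp: shift_def algebra_simps)
    qed (use x in \<open>auto simp: shift_def box_def PiE_iff extensional_def\<close>)
    then show "id ` (\<Union>c\<in>box d k. ?W c) \<subseteq> box d (k * (n + 1))" by auto
  qed auto
  finally show ?thesis .
qed

text \<open>A discrete mean value bound. The induction rests on writing the difference for exponent
  \<open>Suc d\<close> as \<open>(n + 1) * ((n + 1) ^ d - n ^ d) + n ^ d\<close>.\<close>

lemma power_Suc_diff_le: "(n + 1) ^ d - n ^ d \<le> d * (n + 1) ^ (d - 1)" for n d :: nat
proof (induction d)
  case (Suc d)
  have "(n + 1) ^ Suc d = (n + 1) * (((n + 1) ^ d - n ^ d) + n ^ d)"
    by (simp add: power_mono)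
  then have "(n + 1) ^ Suc d = (n + 1) * ((n + 1) ^ d - n ^ d) + n ^ Suc d + n ^ d"
    unfolding distrib_left by simp
  \<comment> \<open>For \<open>d = 0\<close> the exponent \<open>d - 1\<close> is truncated, but
    both sides vanish.\<close>
  moreover have "(n + 1) * ((n + 1) ^ d - n ^ d) \<le> d * (n + 1) ^ d"
    using mult_le_mono2[OF Suc, of "n + 1"] by (cases d) (simp_all add: algebra_simps)
  moreover have "n ^ d \<le> (n + 1) ^ d" by (rule power_mono) auto
  ultimately show ?case by simp
qed simp

text \<open>The shell added to the box has at most \<open>d * (n + 1) ^ (d - 1)\<close> points, and
  an independent set meets it in one of its subsets.\<close>

lemma box_indep_Suc_le: "box_indep d (n + 1) \<le> box_indep d n * 2 ^ (d * (n + 1) ^ (d - 1))"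
proof -
  let ?R = "box d (n + 1) - box d n"
  have U: "box d (n + 1) = box d n \<union> ?R" using box_mono[of n "n + 1" d] by auto
  have "card ?R \<le> d * (n + 1) ^ (d - 1)"
    using power_Suc_diff_le[of n d] box_mono[of n "n + 1" d] by (simp add: card_Diff_subset card_box)
  then have "card (independent_sets (?R, grid_edges d)) \<le> 2 ^ (d * (n + 1) ^ (d - 1))"
    using card_independent_sets_le_pow2[of ?R "grid_edges d"]
    by (meson finite_Diff finite_box le_trans one_le_numeral power_increasing)
  then have "box_indep d n * card (independent_sets (?R, grid_edges d))
      \<le> box_indep d n * 2 ^ (d * (n + 1) ^ (d - 1))"
    by (rule mult_le_mono2)
  moreover have "box_indep d (n + 1) \<le> box_indep d n * card (independent_sets (?R, grid_edges d))"
    unfolding box_indep_def by (subst U, rule card_independent_sets_Un_le) simp_all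
  ultimately show ?thesis by (rule order_trans[rotated])
qed

section \<open>The torus compared with the box\<close>

lemma torus_carrier: "n \<ge> 1 \<Longrightarrow> carrier (torus_group d n) = box d n"
  by (simp add: torus_group_def box_def carrier_integer_mod_group)

lemma torus_mult: "x \<otimes>\<^bsub>torus_group d n\<^esub> y = (\<lambda>j\<in>{..<d}. (x j + y j) mod int n)"
  by (simp add: torus_group_def mult_integer_mod_group)

lemma torus_one: "\<one>\<^bsub>torus_group d n\<^esub> = (\<lambda>j\<in>{..<d}. 0)"
  by (simp add: torus_group_def)

lemma torus_unit_carrier: "n \<ge> 1 \<Longrightarrow> torus_unit d n i \<in> box d n"
  by (auto simp: torus_unit_def box_def)

lemma torus_inv_unit:
  assumes "n \<ge> 1"
  shows "inv\<^bsub>torus_group d n\<^esub> (torus_unit d n i) = (\<lambda>j\<in>{..<d}. if j = i then (- 1) mod int n else 0)"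
proof -
  interpret group "torus_group d n"
    unfolding torus_group_def by (simp add: product_group)
  show ?thesis
    using assms
    by (intro inv_equality)
      (auto simp: torus_carrier torus_unit_carrier torus_mult torus_one torus_unit_def box_def mod_simps)
qed

text \<open>Coordinates in the smaller box are at most \<open>n - 2\<close>: a step up from there is
  not reduced modulo \<open>n\<close>, and a step down from 0 lands on \<open>n - 1\<close>, outside
  the box.\<close>

lemma torus_edges_grid:
  assumes n: "n \<ge> 1" and x: "x \<in> box d (n - 1)" and y: "y \<in> box d (n - 1)"
    and e: "{x, y} \<in> snd (torus_graph d n)"
  shows "{x, y} \<in> grid_edges d"
proof -
  obtain z s where zs: "{x, y} = {z, z \<otimes>\<^bsub>torus_group d n\<^esub> s}" and s: "s \<in> torus_gens d n"
    using e by (auto simp: torus_graph_def cayley_graph_def)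
  \<comment> \<open>The edge is unordered, so \<open>x\<close> may be either end; the argument
    follows the directed step from \<open>z\<close> to \<open>w\<close> instead.\<close>
  define w where "w = z \<otimes>\<^bsub>torus_group d n\<^esub> s"
  have xy: "{x, y} = {z, w}" and "z \<in> box d (n - 1)" "w \<in> box d (n - 1)"
    using zs x y by (auto simp: w_def doubleton_eq_iff)
  then have ext: "z j = undefined" "w j = undefined" if "\<not> j < d" for j
    using that by (auto simp: box_def PiE_iff extensional_def)
  have zr: "0 \<le> z j" "z j < int n - 1" "0 \<le> w j" "w j < int n - 1" if "j < d" for j
    using that n \<open>z \<in> _\<close> \<open>w \<in> _\<close> by (auto simp: box_def PiE_iff of_nat_diff)
  have wj: "w j = (z j + s j) mod int n" if "j < d" for j
    using that by (simp add: w_def torus_mult)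
  obtain i where i: "i < d" and "s = torus_unit d n i \<or> s = inv\<^bsub>torus_group d n\<^esub> (torus_unit d n i)"
    using s by (auto simp: torus_gens_def)
  then consider "s = torus_unit d n i" | "s = (\<lambda>j\<in>{..<d}. if j = i then (- 1) mod int n else 0)"
    using torus_inv_unit[OF n] by auto
  then have "w = z(i := z i + 1) \<or> z = w(i := w i + 1)"
  proof cases
    case 1
    have "w j = (z(i := z i + 1)) j" for j
      using ext[of j] zr[of j] wj[of j] i 1
      by (cases "j < d") (auto simp: torus_unit_def mod_simps split: if_splits)
    then show ?thesis by blast
  next
    case 2
    have "z i \<noteq> 0"
    proof
      assume "z i = 0"
      then have "w i = int n - 1" using wj[OF i] i 2 n by (simp add: mod_simps zmod_minus1)
      then show False using zr[OF i] by simp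
    qed
    then have "z j = (w(i := w i + 1)) j" for j
      using ext[of j] zr[of j] wj[of j] zr[OF i] wj[OF i] i 2
      by (cases "j < d") (auto simp: mod_simps split: if_splits)
    then show ?thesis by blast
  qed
  then show ?thesis unfolding xy grid_edges_iff using i by blast
qed

text \<open>A grid edge with both ends in the box is a step by a generator that does not wrap
  around.\<close>

lemma grid_edges_torus:
  assumes n: "n \<ge> 1" and x: "x \<in> box d n" and y: "y \<in> box d n"
    and e: "{x, y} \<in> grid_edges d"
  shows "{x, y} \<in> snd (torus_graph d n)"
proof -
  have *: "{u, u(i := u i + 1)} \<in> snd (torus_graph d n)"
    if u: "u \<in> box d n" and v: "u(i := u i + 1) \<in> box d n" and i: "i < d" for u i
  proof -
    have uj: "0 \<le> u j" "u j < int n" if "j < d" for j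
      using u that by (auto simp: box_def PiE_iff)
    have ui: "u i + 1 < int n" using v i by (auto simp: box_def PiE_iff split: if_splits)
    \<comment> \<open>Both \<open>u i\<close> and \<open>u i + 1\<close> lie in the range, so
      \<open>n\<close> is at least 2 and \<open>1 mod n\<close> is not 0: the generator survives the
      removal of the neutral element.\<close>
    then have "torus_unit d n i i \<noteq> \<one>\<^bsub>torus_group d n\<^esub> i"
      using uj[OF i] i by (simp add: torus_unit_def torus_one)
    then have "torus_unit d n i \<in> torus_gens d n"
      using i by (auto simp: torus_gens_def)
    moreover have "u(i := u i + 1) = u \<otimes>\<^bsub>torus_group d n\<^esub> torus_unit d n i"
      using u uj ui i
      by (auto simp: torus_mult torus_unit_def fun_eq_iff mod_simps box_def PiE_iff extensional_def)
    ultimately show ?thesis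
      using u n by (auto simp: torus_graph_def cayley_graph_def torus_carrier)
  qed
  from e obtain i where "i < d" "y = x(i := x i + 1) \<or> x = y(i := y i + 1)"
    unfolding grid_edges_iff by blast
  then show ?thesis using *[of x i] *[of y i] x y by (metis insert_commute)
qed

lemma num_indep_eq:
  "n \<ge> 1 \<Longrightarrow> num_indep d n = card (independent_sets (box d n, snd (torus_graph d n)))"
  by (simp add: num_indep_def torus_graph_def cayley_graph_def torus_carrier)

lemma num_indep_le_box_indep: "n \<ge> 1 \<Longrightarrow> num_indep d n \<le> box_indep d n"
  unfolding num_indep_eq box_indep_def
  by (rule card_independent_sets_embed[where f = id]) (auto simp: grid_edges_torus)

lemma box_indep_le_num_indep: "n \<ge> 1 \<Longrightarrow> box_indep d (n - 1) \<le> num_indep d n"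
  unfolding num_indep_eq box_indep_def
  by (rule card_independent_sets_embed[where f = id])
    (use box_mono[of "n - 1" n d] in \<open>auto simp: torus_edges_grid\<close>)

section \<open>The growth rate, the explicit bounds and the limit\<close>

lemma ln_box_indep_compare:
  assumes "m \<ge> 1"
  shows "ln (box_indep d n) / real (n + 1) ^ d \<le> ln (box_indep d m) / real m ^ d"
proof -
  have pos: "0 < real (box_indep d k)" for k by (simp add: box_indep_pos)
  \<comment> \<open>In between lies the count for side \<open>m * (n + 1)\<close>: that box holds
    \<open>m ^ d\<close> separated boxes of side \<open>n\<close> and is tiled by
    \<open>(n + 1) ^ d\<close> boxes of side \<open>m\<close>.\<close>
  have "box_indep d n ^ (m ^ d) \<le> box_indep d m ^ ((n + 1) ^ d)"
    using box_indep_power_le[of d n m] box_indep_mult_le[OF assms, of d "n + 1"]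
    by (simp add: mult.commute)
  then have "real (box_indep d n) ^ (m ^ d) \<le> real (box_indep d m) ^ ((n + 1) ^ d)"
    unfolding of_nat_power[symmetric] of_nat_le_iff .
  then have "ln (real (box_indep d n) ^ (m ^ d)) \<le> ln (real (box_indep d m) ^ ((n + 1) ^ d))"
    using pos by (intro ln_mono) auto
  then have "real m ^ d * ln (box_indep d n) \<le> real (n + 1) ^ d * ln (box_indep d m)"
    by (simp add: ln_realpow pos)
  then show ?thesis using assms by (simp add: field_simps)
qed

text \<open>The constant \<open>K\<close>, later identified as \<open>ln (kappa d)\<close>, is
  obtained before any convergence is known; the first two bounds then yield the limit, the first and
  third the multiplicative estimates.\<close>

lemma ln_num_indep_bounds:
  obtains K :: real where "\<And>n. n \<ge> 1 \<Longrightarrow>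
    real n ^ d * K \<le> ln (num_indep d n) + real (d * n ^ (d - 1)) * ln 2 \<and>
    ln (num_indep d n) \<le> real n ^ d * K + real (d * n ^ (d - 1)) * ln 2 \<and>
    ln (num_indep d n) \<le> real (n + 1) ^ d * K"
proof -
  define u where "u m = ln (box_indep d m) / real m ^ d" for m
  define K where "K = (INF m\<in>{1..}. u m)"
  have pos: "0 < real (box_indep d k)" for k by (simp add: box_indep_pos)
  have low: "ln (box_indep d n) / real (n + 1) ^ d \<le> u m" if "m \<ge> 1" for n m
    unfolding u_def by (rule ln_box_indep_compare[OF that])
  \<comment> \<open>The instance \<open>n = 0\<close> of the comparison gives a lower bound that
    does not depend on \<open>m\<close>.\<close>
  have bdd: "bdd_below (u ` {1..})"
    using low[of _ 0] by (intro bdd_belowI) auto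
  have K1: "ln (box_indep d n) \<le> real (n + 1) ^ d * K" for n
  proof -
    have "ln (box_indep d n) / real (n + 1) ^ d \<le> K"
      unfolding K_def using low by (intro cINF_greatest) auto
    then show ?thesis by (simp add: field_simps)
  qed
  have K2: "real m ^ d * K \<le> ln (box_indep d m)" if "m \<ge> 1" for m
  proof -
    have "K \<le> u m" unfolding K_def using bdd that by (intro cINF_lower) auto
    then show ?thesis using that by (simp add: u_def field_simps)
  qed
  show thesis
  proof (rule that)
    fix n :: nat assume n: "n \<ge> 1"
    define e where "e = d * n ^ (d - 1)"
    have le: "box_indep d (n - 1) \<le> num_indep d n" "num_indep d n \<le> box_indep d n"
      by (rule box_indep_le_num_indep[OF n], rule num_indep_le_box_indep[OF n])
    then have apos: "0 < real (num_indep d n)"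
      using box_indep_pos[of d "n - 1"] by linarith
    have Suc_le: "box_indep d n \<le> box_indep d (n - 1) * 2 ^ e"
      using box_indep_Suc_le[of d "n - 1"] n by (simp add: e_def)
    then have "real (box_indep d n) \<le> real (box_indep d (n - 1) * 2 ^ e)"
      by (simp only: of_nat_le_iff)
    then have "ln (box_indep d n) \<le> ln (box_indep d (n - 1) * 2 ^ e)"
      using pos by (intro ln_mono) auto
    also have "\<dots> = ln (box_indep d (n - 1)) + real e * ln 2"
      using pos by (simp add: ln_mult ln_realpow)
    finally have step: "ln (box_indep d n) \<le> ln (box_indep d (n - 1)) + real e * ln 2" .
    have "ln (box_indep d (n - 1)) \<le> ln (num_indep d n)" "ln (num_indep d n) \<le> ln (box_indep d n)"
      using le pos apos by (simp_all add: ln_le_cancel_iff)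
    \<comment> \<open>The first bound chains \<open>K2\<close> at \<open>n\<close> with
      \<open>step\<close>; the second chains \<open>step\<close> with \<open>K1\<close> at
      \<open>n - 1\<close>, whose factor is exactly \<open>n ^ d\<close>; the third is
      \<open>K1\<close> at \<open>n\<close>.\<close>
    then show "real n ^ d * K \<le> ln (num_indep d n) + real (d * n ^ (d - 1)) * ln 2 \<and>
        ln (num_indep d n) \<le> real n ^ d * K + real (d * n ^ (d - 1)) * ln 2 \<and>
        ln (num_indep d n) \<le> real (n + 1) ^ d * K"
      using step K1[of n] K1[of "n - 1"] K2[OF n] n unfolding e_def by auto
  qed
qed

theorem theorem2p6:
  fixes d :: nat
  assumes "d \<ge> 1"
  shows "convergent (indep_root d) \<and>
    (\<forall>n::nat. n \<ge> 1 \<longrightarrow>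
      kappa d ^ (n ^ d) * 2 powr (- real (d * n ^ (d - 1))) \<le> real (num_indep d n) \<and>
      real (num_indep d n) \<le> kappa d ^ ((n + 1) ^ d) \<and>
      \<bar>1 / real (n ^ d) * ln (real (num_indep d n)) - ln (kappa d)\<bar> \<le> real d * ln 2 / real n)"
proof -
  obtain K where K: "\<And>n. n \<ge> 1 \<Longrightarrow>
      real n ^ d * K \<le> ln (num_indep d n) + real (d * n ^ (d - 1)) * ln 2 \<and>
      ln (num_indep d n) \<le> real n ^ d * K + real (d * n ^ (d - 1)) * ln 2 \<and>
      ln (num_indep d n) \<le> real (n + 1) ^ d * K"
    using ln_num_indep_bounds by blast
  have apos: "0 < real (num_indep d n)" if "n \<ge> 1" for n
    using box_indep_le_num_indep[OF that, of d] box_indep_pos[of d "n - 1"] by linarith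
  have close: "\<bar>1 / real (n ^ d) * ln (num_indep d n) - K\<bar> \<le> real d * ln 2 / real n"
    if n: "n \<ge> 1" for n
  proof -
    have "\<bar>ln (num_indep d n) - real n ^ d * K\<bar> \<le> real (d * n ^ (d - 1)) * ln 2"
      using K[OF n] by (simp add: abs_le_iff)
    then have "\<bar>ln (num_indep d n) - real n ^ d * K\<bar> / real n ^ d
        \<le> real (d * n ^ (d - 1)) * ln 2 / real n ^ d"
      by (rule divide_right_mono) simp
    \<comment> \<open>Here \<open>d\<close> must be positive: cancelling \<open>n ^ (d - 1)\<close>
      turns the boundary error into order \<open>1 / n\<close>.\<close>
    moreover have "real n ^ d = real n * real n ^ (d - 1)"
      using assms by (simp flip: power_Suc)
    then have "real (d * n ^ (d - 1)) * ln 2 / real n ^ d = real d * ln 2 / real n"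
      using n by (simp add: field_simps)
    moreover have "\<bar>ln (num_indep d n) - real n ^ d * K\<bar> / real n ^ d
        = \<bar>(ln (num_indep d n) - real n ^ d * K) / real n ^ d\<bar>"
      by simp
    moreover have "(ln (num_indep d n) - real n ^ d * K) / real n ^ d
        = 1 / real (n ^ d) * ln (num_indep d n) - K"
      using n by (simp add: field_simps)
    ultimately show ?thesis by simp
  qed
  have "(\<lambda>n. 1 / real (n ^ d) * ln (num_indep d n) - K) \<longlonglongrightarrow> 0"
  proof (rule tendsto_0_le)
    show "(\<lambda>n. real d * ln 2 / real n) \<longlonglongrightarrow> 0"
      by (rule lim_const_over_n)
    show "\<forall>\<^sub>F n in sequentially. norm (1 / real (n ^ d) * ln (num_indep d n) - K)
        \<le> norm (real d * ln 2 / real n) * 1"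
      using close by (intro eventually_sequentiallyI[of 1]) simp
  qed
  then have "(\<lambda>n. 1 / real (n ^ d) * ln (num_indep d n)) \<longlonglongrightarrow> K"
    by (simp add: LIM_zero_iff)
  then have "(\<lambda>n. exp (1 / real (n ^ d) * ln (num_indep d n))) \<longlonglongrightarrow> exp K"
    by (rule tendsto_exp)
  \<comment> \<open>Positivity of the count lets \<open>powr\<close> unfold to \<open>exp\<close>;
    starting at 1 avoids the degenerate term at 0.\<close>
  moreover have "\<forall>\<^sub>F n in sequentially. exp (1 / real (n ^ d) * ln (num_indep d n)) = indep_root d n"
    using apos by (intro eventually_sequentiallyI[of 1]) (simp add: indep_root_def powr_def)
  ultimately have lim: "indep_root d \<longlonglongrightarrow> exp K"
    by (rule Lim_transform_eventually)
  \<comment> \<open>From here \<open>ln (kappa d)\<close> is \<open>K\<close>, so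
    \<open>close\<close> is the logarithmic estimate, and exponentiating the bounds on
    \<open>K\<close> gives the other two.\<close>
  then have kappa: "kappa d = exp K"
    by (simp add: kappa_def limI)
  have "kappa d ^ (n ^ d) * 2 powr (- real (d * n ^ (d - 1))) \<le> real (num_indep d n) \<and>
      real (num_indep d n) \<le> kappa d ^ ((n + 1) ^ d)" if n: "n \<ge> 1" for n
  proof
    have "kappa d ^ (n ^ d) * 2 powr (- real (d * n ^ (d - 1)))
        = exp (real n ^ d * K - real (d * n ^ (d - 1)) * ln 2)"
      by (simp add: kappa powr_def exp_diff exp_minus divide_inverse flip: exp_of_nat_mult)
    also have "\<dots> \<le> exp (ln (num_indep d n))" using K[OF n] by simp
    finally show "kappa d ^ (n ^ d) * 2 powr (- real (d * n ^ (d - 1))) \<le> real (num_indep d n)"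
      using apos[OF n] by simp
    have "exp (ln (num_indep d n)) \<le> exp (real (n + 1) ^ d * K)" using K[OF n] by simp
    also have "\<dots> = kappa d ^ ((n + 1) ^ d)"
      unfolding kappa exp_of_nat_mult[symmetric] by simp
    finally show "real (num_indep d n) \<le> kappa d ^ ((n + 1) ^ d)"
      using apos[OF n] by simp
  qed
  with lim close kappa show ?thesis by (auto simp: convergent_def)
qed

end
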